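(* Let $T\ge 2$, let $(\Omega,\mathcal{F},P)$ be a probability space with filtration $\mathcal{F}_1\subset\dots\subset\mathcal{F}_T=\mathcal{F}$ generated by a random data process $\{\xi_t\}_{t=1}^T$, and write $\xi_{[t]}=(\xi_1,\dots,\xi_t)$. Let $\mathbf{X}=(X_1,\dots,X_T)$ and $\mathbf{Y}=(Y_1,\dots,Y_T)$ be two sequences of random variables with $X_t,Y_t\in\mathcal{L}_1(\Omega,\mathcal{F}_t,P)$ for $t=1,\dots,T$. Suppose that for almost all histories $\xi_{[T-1]}$ $$\sigma_{T-1}(\xi_{[T-1]})+\mathbf{X}_T\,|\,\xi_{[T-1]}\ \succeq_{(2)}\ \mathbf{Y}_T\,|\,\xi_{[T-1]}.$$ Then the dynamic second-order stochastic dominance relation between $\mathbf{X}$ and $\mathbf{Y}$ holds, i.e., for every $t=1,\dots,T-1$ and almost all histories $\xi_{[t]}$, $$\sigma_t(\xi_{[t]})+\mathbf{X}_{t+1}\,|\,\xi_{[t]}\ \succeq_{(2)}\ \mathbf{Y}_{t+1}\,|\,\xi_{[t]}.$$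
   Context: Second-order stochastic dominance: for integrable real random variables $V,Z$, with $F_Z(\eta)=P(Z\le\eta)$ and $F^{(2)}_Z(\eta)=\int_{-\infty}^{\eta}F_Z(s)\,ds$, one writes $V\succeq_{(2)}Z$ if $F^{(2)}_V(\eta)\le F^{(2)}_Z(\eta)$ for all $\eta\in\mathbb{R}$; equivalently, $\mathbb{E}[(\eta-V)_+]\le\mathbb{E}[(\eta-Z)_+]$ for all $\eta\in\mathbb{R}$, where $a_+=\max(0,a)$. Sequences: $\mathcal{F}_t$ is the $\sigma$-algebra generated by $\xi_{[t]}$, and $\mathbb{E}_t[\cdot]$ denotes conditional expectation given $\mathcal{F}_t$. For $t=1,\dots,T$ the accumulated sums are $\mathbf{x}_t(\xi_{[t]})=(X_1+\dots+X_t)(\xi_{[t]})$ and $\mathbf{y}_t(\xi_{[t]})=(Y_1+\dots+Y_t)(\xi_{[t]})$, and the accumulated difference is $\sigma_t(\xi_{[t]})=\mathbf{x}_t(\xi_{[t]})-\mathbf{y}_t(\xi_{[t]})$. For $t=1,\dots,T-1$, the projected future value of $\mathbf{X}$ at time $t$, with the history $\xi_{[t]}$ fixed, is $$\mathbf{X}_{t+1}\,|\,\xi_{[t]}=X_{t+1}|\xi_{[t]}+\mathbb{E}_{t+1}\Big[X_{t+2}|\xi_{[t]}+\mathbb{E}_{t+2}\big[X_{t+3}|\xi_{[t]}+\cdots+\mathbb{E}_{T-1}[X_T|\xi_{[t]}]\big]\Big],$$ that is, the $\mathcal{F}_{t+1}$-measurable random variable $X_{t+1}+\mathbb{E}_{t+1}[X_{t+2}+\dots+X_T]$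 regarded under its conditional distribution given the history $\xi_{[t]}$ (for $t=T-1$ it is just $X_T$ under its conditional distribution given $\xi_{[T-1]}$). $\mathbf{Y}_{t+1}\,|\,\xi_{[t]}$ is defined in the same way. For a fixed history $\xi_{[t]}$, $\sigma_t(\xi_{[t]})$ is a constant, and the relation $\succeq_{(2)}$ in the claim compares the conditional distributions given $\xi_{[t]}$ of the two sides. *)

theory Defs
  imports "HOL-Probability.Probability"
begin

text \<open>
  The function \<open>F\<^sup>(\<^sup>2\<^sup>)\<close> of a distribution, i.e. the integral of its distribution function over
  \<open>{..\<eta>}\<close>. The integrand is nonnegative, so the integral is taken in \<^typ>\<open>ennreal\<close>; it is finite
  for every \<open>\<eta>\<close> if the distribution has a first moment.
\<close>

definition cdf2 :: "real measure \<Rightarrow> real \<Rightarrow> ennreal" where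
  "cdf2 \<mu> \<eta> = (\<integral>\<^sup>+ s \<in> {..\<eta>}. ennreal (cdf \<mu> s) \<partial>lborel)"

definition ssd :: "real measure \<Rightarrow> real measure \<Rightarrow> bool"  (infix "\<succeq>\<^sub>2" 50) where
  "\<mu> \<succeq>\<^sub>2 \<nu> \<longleftrightarrow> (\<forall>\<eta>. cdf2 \<mu> \<eta> \<le> cdf2 \<nu> \<eta>)"

definition is_cond_distr ::
  "'a measure \<Rightarrow> 'a measure \<Rightarrow> ('a \<Rightarrow> real) \<Rightarrow> ('a \<Rightarrow> real measure) \<Rightarrow> bool" where
  "is_cond_distr M F V \<kappa> \<longleftrightarrow>
     \<kappa> \<in> F \<rightarrow>\<^sub>M prob_algebra borel \<and>
     (\<forall>B \<in> sets borel.
        AE \<omega> in M. measure (\<kappa> \<omega>) B = real_cond_exp M F (\<lambda>\<omega>. indicator B (V \<omega>)) \<omega>)"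

text \<open>
  As for \<^const>\<open>real_cond_exp\<close>, some version is chosen; any two versions agree almost everywhere.
  Existence is shown in \<open>is_cond_distr_cond_distr\<close> below.
\<close>

definition cond_distr :: "'a measure \<Rightarrow> 'a measure \<Rightarrow> ('a \<Rightarrow> real) \<Rightarrow> 'a \<Rightarrow> real measure" where
  "cond_distr M F V = (SOME \<kappa>. is_cond_distr M F V \<kappa>)"

definition history :: "(nat \<Rightarrow> 'a \<Rightarrow> 'b) \<Rightarrow> nat \<Rightarrow> 'a \<Rightarrow> nat \<Rightarrow> 'b" where
  "history \<xi> t \<omega> = (\<lambda>s\<in>{1..t}. \<xi> s \<omega>)"

definition history_algebra ::
  "'a measure \<Rightarrow> (nat \<Rightarrow> 'b measure) \<Rightarrow> (nat \<Rightarrow> 'a \<Rightarrow> 'b) \<Rightarrow> nat \<Rightarrow> 'a measure" where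
  "history_algebra M N \<xi> t = vimage_algebra (space M) (history \<xi> t) (\<Pi>\<^sub>M s\<in>{1..t}. N s)"

definition acc_sum :: "(nat \<Rightarrow> 'a \<Rightarrow> real) \<Rightarrow> nat \<Rightarrow> 'a \<Rightarrow> real" where
  "acc_sum X t \<omega> = (\<Sum>s=1..t. X s \<omega>)"

definition acc_diff :: "(nat \<Rightarrow> 'a \<Rightarrow> real) \<Rightarrow> (nat \<Rightarrow> 'a \<Rightarrow> real) \<Rightarrow> nat \<Rightarrow> 'a \<Rightarrow> real" where
  "acc_diff X Y t \<omega> = acc_sum X t \<omega> - acc_sum Y t \<omega>"

text \<open>
  \<open>nested_value M F X s k\<close> is \<open>X\<^sub>s + E\<^sub>s[X\<^sub>s\<^sub>+\<^sub>1 + E\<^sub>s\<^sub>+\<^sub>1[\<dots> + E\<^sub>s\<^sub>+\<^sub>k\<^sub>-\<^sub>1[X\<^sub>s\<^sub>+\<^sub>k]]]\<close>,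
  where \<open>E\<^sub>s\<close> is the conditional expectation given \<open>F s\<close>.
\<close>

fun nested_value ::
  "'a measure \<Rightarrow> (nat \<Rightarrow> 'a measure) \<Rightarrow> (nat \<Rightarrow> 'a \<Rightarrow> real) \<Rightarrow> nat \<Rightarrow> nat \<Rightarrow> 'a \<Rightarrow> real" where
  "nested_value M F X s 0 = X s"
| "nested_value M F X s (Suc k) =
     (\<lambda>\<omega>. X s \<omega> + real_cond_exp M (F s) (nested_value M F X (Suc s) k) \<omega>)"

definition future_value ::
  "'a measure \<Rightarrow> (nat \<Rightarrow> 'a measure) \<Rightarrow> nat \<Rightarrow> (nat \<Rightarrow> 'a \<Rightarrow> real) \<Rightarrow> nat \<Rightarrow> 'a \<Rightarrow> real" where
  "future_value M F T X t = nested_value M F X (t + 1) (T - (t + 1))"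

text \<open>
  The almost sure relation \<open>\<sigma>\<^sub>t + X\<^sub>t\<^sub>+\<^sub>1 | \<xi>\<^sub>[\<^sub>t\<^sub>] \<succeq> Y\<^sub>t\<^sub>+\<^sub>1 | \<xi>\<^sub>[\<^sub>t\<^sub>]\<close>. The history enters through
  the outcome \<open>\<omega>\<close> that generates it: the conditional distributions are \<open>F t\<close>-measurable functions
  of \<open>\<omega>\<close>. The one on the left is translated by the number \<open>\<sigma>\<^sub>t(\<omega>)\<close>.
\<close>

definition dominates_at ::
  "'a measure \<Rightarrow> (nat \<Rightarrow> 'a measure) \<Rightarrow> nat \<Rightarrow> (nat \<Rightarrow> 'a \<Rightarrow> real) \<Rightarrow> (nat \<Rightarrow> 'a \<Rightarrow> real) \<Rightarrow>
     nat \<Rightarrow> bool" where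
  "dominates_at M F T X Y t \<longleftrightarrow>
     (AE \<omega> in M.
        distr (cond_distr M (F t) (future_value M F T X t) \<omega>) borel (\<lambda>x. acc_diff X Y t \<omega> + x)
        \<succeq>\<^sub>2 cond_distr M (F t) (future_value M F T Y t) \<omega>)"

lemma L1_subseq_AE:
  fixes g :: "nat \<Rightarrow> 'a \<Rightarrow> real"
  assumes "\<And>n. integrable M (g n)" "integrable M c"
    and "\<And>n. AE \<omega> in M. c \<omega> \<le> g n \<omega>"
    and "(\<lambda>n. \<integral>\<omega>. g n \<omega> \<partial>M) \<longlonglongrightarrow> (\<integral>\<omega>. c \<omega> \<partial>M)"
  shows "\<exists>r. strict_mono r \<and> (AE \<omega> in M. (\<lambda>n. g (r n) \<omega>) \<longlonglongrightarrow> c \<omega>)"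
proof -
  have e: "(\<integral>\<omega>. norm (g n \<omega> - c \<omega>) \<partial>M) = (\<integral>\<omega>. g n \<omega> \<partial>M) - (\<integral>\<omega>. c \<omega> \<partial>M)" for n
  proof -
    have "(\<integral>\<omega>. norm (g n \<omega> - c \<omega>) \<partial>M) = (\<integral>\<omega>. g n \<omega> - c \<omega> \<partial>M)"
      using assms(1)[of n] assms(2) assms(3)[of n] by (intro integral_cong_AE) auto
    then show ?thesis using assms(1,2) by simp
  qed
  have "(\<lambda>n. \<integral>\<omega>. norm (g n \<omega> - c \<omega>) \<partial>M) \<longlonglongrightarrow> 0"
    unfolding e using tendsto_diff[OF assms(4) tendsto_const[of "\<integral>\<omega>. c \<omega> \<partial>M"]] by simp
  then obtain r where r: "strict_mono r" "AE \<omega> in M. (\<lambda>n. g (r n) \<omega> - c \<omega>) \<longlonglongrightarrow> 0"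
    using tendsto_L1_AE_subseq[of M "\<lambda>n \<omega>. g n \<omega> - c \<omega>"] assms(1,2) by auto
  from r(2) have "AE \<omega> in M. (\<lambda>n. g (r n) \<omega>) \<longlonglongrightarrow> c \<omega>"
    by eventually_elim (simp add: LIM_zero_iff)
  with r(1) show ?thesis by blast
qed

lemma ex_is_cond_distr:
  assumes "prob_space M" and sub: "subalgebra M F" and V [measurable]: "V \<in> borel_measurable M"
  shows "\<exists>\<kappa>. is_cond_distr M F V \<kappa>"
proof -
  interpret prob_space M by fact
  interpret finite_measure_subalgebra M F by unfold_locales (rule sub)
  have spF: "space F = space M" using sub by (simp add: subalgebra_def)
  have measF: "f \<in> borel_measurable M" if "f \<in> borel_measurable F" for f :: "'a \<Rightarrow> real"
    using measurable_from_subalg[OF sub that] .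
  define E where "E = (\<lambda>x::real. real_cond_exp M F (\<lambda>\<omega>. indicator {..x} (V \<omega>)))"
  have EF: "E x \<in> borel_measurable F" for x unfolding E_def by simp
  have ii: "integrable M (\<lambda>\<omega>. indicator B (V \<omega>) :: real)" if "B \<in> sets borel" for B
    using that by (intro integrable_const_bound[where B=1]) (auto simp: indicator_def)
  have Ei: "integrable M (E x)" and EI: "(\<integral>\<omega>. E x \<omega> \<partial>M) = measure M {\<omega>\<in>space M. V \<omega> \<le> x}" for x
  proof -
    show "integrable M (E x)" unfolding E_def using real_cond_exp_int(1)[OF ii[of "{..x}"]] by simp
    have "(\<integral>\<omega>. E x \<omega> \<partial>M) = (\<integral>\<omega>. indicator {..x} (V \<omega>) \<partial>M)"
      unfolding E_def using real_cond_exp_int(2)[OF ii[of "{..x}"]] by simp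
    also have "\<dots> = (\<integral>\<omega>. indicator {\<omega>\<in>space M. V \<omega> \<le> x} \<omega> \<partial>M)"
      by (intro Bochner_Integration.integral_cong) (auto simp: indicator_def)
    finally show "(\<integral>\<omega>. E x \<omega> \<partial>M) = measure M {\<omega>\<in>space M. V \<omega> \<le> x}" by simp
  qed
  have EI': "(\<integral>\<omega>. E x \<omega> \<partial>M) = cdf (distr M borel V) x" for x
    unfolding EI cdf_def by (subst measure_distr) (auto intro!: arg_cong[where f="measure M"])
  interpret D: real_distribution "distr M borel V" by simp
  have E_mono: "AE \<omega> in M. E x \<omega> \<le> E y \<omega>" if "x \<le> y" for x y
    unfolding E_def using that by (intro real_cond_exp_mono ii) (auto simp: indicator_def)
  have E_0: "AE \<omega> in M. 0 \<le> E x \<omega>" for x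
    unfolding E_def by (intro real_cond_exp_pos) auto
  have E_1: "AE \<omega> in M. E x \<omega> \<le> 1" for x
    unfolding E_def by (intro real_cond_exp_le_c ii) (auto simp: indicator_def)
  define good where "good = (\<lambda>\<omega>. (\<forall>q r::rat. q \<le> r \<longrightarrow> E (of_rat q) \<omega> \<le> E (of_rat r) \<omega>) \<and>
     (\<forall>q::rat. 0 \<le> E (of_rat q) \<omega> \<and> E (of_rat q) \<omega> \<le> 1) \<and>
     (\<lambda>n. E (real n) \<omega>) \<longlonglongrightarrow> 1 \<and> (\<lambda>n. E (- real n) \<omega>) \<longlonglongrightarrow> 0)"
  have good_meas [measurable]: "Measurable.pred F good"
    unfolding good_def using EF[measurable] by measurable
  have good_AE: "AE \<omega> in M. good \<omega>"
  proof -
    have "\<exists>r. strict_mono r \<and> (AE \<omega> in M. (\<lambda>n. 1 - E (real (r n)) \<omega>) \<longlonglongrightarrow> 0)"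
    proof (rule L1_subseq_AE)
      show "(\<lambda>n. \<integral>\<omega>. 1 - E (real n) \<omega> \<partial>M) \<longlonglongrightarrow> (\<integral>\<omega>. 0 \<partial>M)"
        using tendsto_diff[OF tendsto_const[of "1::real"] D.cdf_lim_infty_prob] Ei
        by (simp add: EI' prob_space)
    qed (use Ei E_1 in auto)
    then obtain r1 where r1: "strict_mono r1"
      "AE \<omega> in M. (\<lambda>n. 1 - E (real (r1 n)) \<omega>) \<longlonglongrightarrow> 0" by blast
    have "\<exists>r. strict_mono r \<and> (AE \<omega> in M. (\<lambda>n. E (- real (r n)) \<omega>) \<longlonglongrightarrow> 0)"
      by (rule L1_subseq_AE) (use Ei E_0 D.cdf_lim_neg_infty in \<open>auto simp: EI'\<close>)
    then obtain r2 where r2: "strict_mono r2"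
      "AE \<omega> in M. (\<lambda>n. E (- real (r2 n)) \<omega>) \<longlonglongrightarrow> 0" by blast
    have m: "AE \<omega> in M. \<forall>q r::rat. q \<le> r \<longrightarrow> E (of_rat q) \<omega> \<le> E (of_rat r) \<omega>"
      unfolding AE_all_countable using E_mono by (auto simp: of_rat_less_eq)
    have b: "AE \<omega> in M. \<forall>q::rat. 0 \<le> E (of_rat q) \<omega> \<and> E (of_rat q) \<omega> \<le> 1"
      unfolding AE_all_countable using E_0 E_1 by (auto intro: AE_conjI)
    from r1(2) r2(2) m b show ?thesis
    proof eventually_elim
      case (elim \<omega>)
      have mono: "E (real m) \<omega> \<le> E (real n) \<omega>" "E (- real n) \<omega> \<le> E (- real m) \<omega>"
        if "m \<le> n" for m n
        using elim(3)[rule_format, of "of_nat m" "of_nat n"]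
          elim(3)[rule_format, of "- of_nat n" "- of_nat m"] that
        by (simp_all add: of_rat_minus)
      have bd: "0 \<le> E (real n) \<omega>" "E (real n) \<omega> \<le> 1" "0 \<le> E (- real n) \<omega>" "E (- real n) \<omega> \<le> 1" for n
        using elim(4)[rule_format, of "of_nat n"] elim(4)[rule_format, of "- of_nat n"]
        by (simp_all add: of_rat_minus)
      have "(\<lambda>n. E (real n) \<omega>) \<longlonglongrightarrow> 1"
      proof (rule LIMSEQ_I)
        fix e :: real assume "0 < e"
        from LIMSEQ_D[OF elim(1) this] obtain k where "\<bar>1 - E (real (r1 k)) \<omega>\<bar> < e" by auto
        then have "norm (E (real n) \<omega> - 1) < e" if "r1 k \<le> n" for n
          using mono(1)[OF that] bd(2)[of n] by auto
        then show "\<exists>no. \<forall>n\<ge>no. norm (E (real n) \<omega> - 1) < e" by blast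
      qed
      moreover have "(\<lambda>n. E (- real n) \<omega>) \<longlonglongrightarrow> 0"
      proof (rule LIMSEQ_I)
        fix e :: real assume "0 < e"
        from LIMSEQ_D[OF elim(2) this] obtain k where "\<bar>E (- real (r2 k)) \<omega>\<bar> < e" by auto
        then have "norm (E (- real n) \<omega> - 0) < e" if "r2 k \<le> n" for n
          using mono(2)[OF that] bd(3)[of n] by auto
        then show "\<exists>no. \<forall>n\<ge>no. norm (E (- real n) \<omega> - 0) < e" by blast
      qed
      ultimately show ?case using elim(3,4) by (simp add: good_def)
    qed
  qed
  define G where "G = (\<lambda>(q::rat) \<omega>. if good \<omega> then E (of_rat q) \<omega> else indicator {0..} q)"
  define H where "H = (\<lambda>\<omega> (x::real). INF q\<in>{q::rat. x < of_rat q}. G q \<omega>)"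
  have G_meas: "G q \<in> borel_measurable F" for q
    unfolding G_def using EF[measurable] by measurable
  have G01: "0 \<le> G q \<omega>" "G q \<omega> \<le> 1" for q \<omega>
    by (auto simp: G_def good_def indicator_def)
  have G_mono: "G q \<omega> \<le> G r \<omega>" if "q \<le> r" for q r \<omega>
    using that by (auto simp: G_def good_def indicator_def)
  have ne: "{q::rat. x < of_rat q} \<noteq> {}" for x :: real
    using of_rat_dense[of x "x + 1"] by auto
  have bdd: "bdd_below ((\<lambda>q. G q \<omega>) ` Q)" for \<omega> Q
    using G01(1) by (auto intro!: bdd_belowI2)
  have H_le: "H \<omega> x \<le> G q \<omega>" if "x < of_rat q" for \<omega> x q
    unfolding H_def using that by (intro cINF_lower bdd) auto
  have H_ge: "c \<le> H \<omega> x" if "\<And>q. x < of_rat q \<Longrightarrow> c \<le> G q \<omega>" for c \<omega> x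
    unfolding H_def using that by (intro cINF_greatest ne) auto
  have H_meas: "(\<lambda>\<omega>. H \<omega> x) \<in> borel_measurable F" for x
    unfolding H_def using bdd ne G_meas by (intro borel_measurable_cINF) auto
  have H01: "0 \<le> H \<omega> x" "H \<omega> x \<le> 1" for \<omega> x
  proof -
    show "0 \<le> H \<omega> x" using G01 by (intro H_ge) auto
    obtain q where "x < of_rat q" using ne by blast
    from H_le[OF this] G01(2) show "H \<omega> x \<le> 1" by (rule order_trans)
  qed
  have H_mono: "H \<omega> x \<le> H \<omega> y" if "x \<le> y" for \<omega> x y
    using that by (intro H_ge H_le) auto
  have H_right: "continuous (at_right x) (H \<omega>)" for \<omega> x
    unfolding continuous_within
  proof (rule order_tendstoI)
    fix a assume "a < H \<omega> x"
    then show "\<forall>\<^sub>F y in at_right x. a < H \<omega> y"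
      unfolding eventually_at_right_field
      by (intro exI[of _ "x + 1"]) (auto intro: less_le_trans[OF _ H_mono])
  next
    fix a assume "H \<omega> x < a"
    then obtain q where q: "x < of_rat q" "G q \<omega> < a"
      using H_ge[of x a \<omega>] by force
    then show "\<forall>\<^sub>F y in at_right x. H \<omega> y < a"
      unfolding eventually_at_right_field
      by (intro exI[of _ "of_rat q"]) (auto intro: le_less_trans[OF H_le])
  qed
  have good_lim: "(\<lambda>n. E (real n) \<omega>) \<longlonglongrightarrow> 1" "(\<lambda>n. E (- real n) \<omega>) \<longlonglongrightarrow> 0"
    if "good \<omega>" for \<omega>
    using that by (simp_all add: good_def)
  have G_top: "(\<lambda>n. G (of_nat n) \<omega>) \<longlonglongrightarrow> 1" for \<omega>
    using good_lim(1)[of \<omega>] by (cases "good \<omega>") (simp_all add: G_def)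
  have G_bot: "(\<lambda>n. G (- of_nat n) \<omega>) \<longlonglongrightarrow> 0" for \<omega>
  proof (cases "good \<omega>")
    case False
    have "\<forall>\<^sub>F n in sequentially. G (- of_nat n) \<omega> = 0"
      using eventually_gt_at_top[of 0] by eventually_elim (use False in \<open>simp add: G_def\<close>)
    then show ?thesis by (rule tendsto_eventually)
  qed (use good_lim(2)[of \<omega>] in \<open>simp add: G_def of_rat_minus\<close>)
  have H_top: "(H \<omega> \<longlongrightarrow> 1) at_top" for \<omega>
  proof (rule order_tendstoI)
    fix a :: real assume "a < 1"
    from order_tendstoD(1)[OF G_top this, of \<omega>] obtain n where n: "a < G (of_nat n) \<omega>"
      unfolding eventually_sequentially by blast
    have "a < H \<omega> y" if "real n \<le> y" for y
    proof (rule less_le_trans[OF n], rule H_ge)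
      fix q :: rat assume "y < of_rat q"
      with that have "of_rat (of_nat n) \<le> (of_rat q :: real)" by simp
      then show "G (of_nat n) \<omega> \<le> G q \<omega>" by (intro G_mono) (simp only: of_rat_less_eq)
    qed
    then show "\<forall>\<^sub>F y in at_top. a < H \<omega> y" by (auto simp: eventually_at_top_linorder)
  next
    fix a :: real assume "1 < a"
    then show "\<forall>\<^sub>F y in at_top. H \<omega> y < a"
      using H01(2) by (intro always_eventually) (auto intro: le_less_trans)
  qed
  have H_bot: "(H \<omega> \<longlongrightarrow> 0) at_bot" for \<omega>
  proof (rule order_tendstoI)
    fix a :: real assume "0 < a"
    from order_tendstoD(2)[OF G_bot this, of \<omega>] obtain n where n: "G (- of_nat n) \<omega> < a"
      unfolding eventually_sequentially by blast
    have "H \<omega> y < a" if "y \<le> - real n - 1" for y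
      using H_le[of y "- of_nat n" \<omega>] that n by (auto simp: of_rat_minus)
    then show "\<forall>\<^sub>F y in at_bot. H \<omega> y < a" by (auto simp: eventually_at_bot_linorder)
  next
    fix a :: real assume "a < 0"
    then show "\<forall>\<^sub>F y in at_bot. a < H \<omega> y"
      using H01(1) by (intro always_eventually) (auto intro: less_le_trans)
  qed
  define \<kappa> where "\<kappa> = (\<lambda>\<omega>. interval_measure (H \<omega>))"
  have rd: "real_distribution (\<kappa> \<omega>)" for \<omega>
    unfolding \<kappa>_def by (intro real_distribution_interval_measure H_mono H_right H_top H_bot)
  have \<kappa>_Iic: "emeasure (\<kappa> \<omega>) {..x} = ennreal (H \<omega> x)" for \<omega> x
    unfolding \<kappa>_def by (intro emeasure_interval_measure_Iic H_mono H_right H_bot)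
  have \<kappa>_F: "\<kappa> \<in> F \<rightarrow>\<^sub>M prob_algebra borel"
  proof (rule measurable_prob_algebra_generated[where G="range atMost" and \<Omega>=UNIV])
    show "sets borel = sigma_sets UNIV (range (atMost :: real \<Rightarrow> real set))"
      by (subst borel_eq_atMost) simp
    show "Int_stable (range (atMost :: real \<Rightarrow> real set))"
      by (auto simp: Int_stable_def)
    show "prob_space (\<kappa> \<omega>)" for \<omega> using rd[of \<omega>] by (simp add: real_distribution_def)
    show "sets (\<kappa> \<omega>) = sets borel" for \<omega> by (simp add: \<kappa>_def)
    show "(\<lambda>\<omega>. emeasure (\<kappa> \<omega>) A) \<in> borel_measurable F" if "A \<in> range atMost" for A
      using that H_meas by (auto simp: \<kappa>_Iic)
  qed auto
  have HE: "AE \<omega> in M. H \<omega> x = E x \<omega>" for x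
  proof -
    have "\<exists>q::rat. x < of_rat q \<and> of_rat q < x + 1 / real (Suc n)" for n
      by (intro of_rat_dense) simp
    then obtain q :: "nat \<Rightarrow> rat" where
      q: "\<And>n. x < of_rat (q n)" "\<And>n. of_rat (q n) < x + 1 / real (Suc n)" by metis
    have "(\<lambda>n. real_of_rat (q n)) \<longlonglongrightarrow> x"
    proof (rule tendsto_sandwich[OF _ _ tendsto_const[of x]])
      show "(\<lambda>n. x + 1 / real (Suc n)) \<longlonglongrightarrow> x"
        using tendsto_add[OF tendsto_const[of x] LIMSEQ_Suc[OF lim_1_over_n]] by simp
      show "\<forall>\<^sub>F n in sequentially. x \<le> of_rat (q n)"
        using q(1) by (simp add: less_imp_le)
      show "\<forall>\<^sub>F n in sequentially. of_rat (q n) \<le> x + 1 / real (Suc n)"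
        using q(2) by (intro always_eventually allI less_imp_le)
    qed
    then have "filterlim (\<lambda>n. real_of_rat (q n)) (at_right x) sequentially"
      using q(1) by (auto simp: filterlim_at intro!: always_eventually)
    from filterlim_compose[OF D.cdf_is_right_cont[unfolded continuous_within] this]
    have lim: "(\<lambda>n. cdf (distr M borel V) (of_rat (q n))) \<longlonglongrightarrow> cdf (distr M borel V) x" .
    have "\<exists>r. strict_mono r \<and> (AE \<omega> in M. (\<lambda>n. E (of_rat (q (r n))) \<omega>) \<longlonglongrightarrow> E x \<omega>)"
      by (rule L1_subseq_AE) (use Ei lim q(1) in \<open>auto simp: EI' intro!: E_mono less_imp_le\<close>)
    then obtain r where r: "AE \<omega> in M. (\<lambda>n. E (of_rat (q (r n))) \<omega>) \<longlonglongrightarrow> E x \<omega>" by blast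
    have "AE \<omega> in M. \<forall>q::rat. x < of_rat q \<longrightarrow> E x \<omega> \<le> E (of_rat q) \<omega>"
      unfolding AE_all_countable using E_mono[of x] by (auto simp: less_imp_le)
    with r good_AE show ?thesis
    proof eventually_elim
      case (elim \<omega>)
      then have G: "G p \<omega> = E (of_rat p) \<omega>" for p by (simp add: G_def)
      show ?case
      proof (rule antisym)
        show "H \<omega> x \<le> E x \<omega>"
          using H_le[OF q(1), of \<omega>] by (intro LIMSEQ_le_const[OF elim(1)]) (auto simp: G)
        show "E x \<omega> \<le> H \<omega> x" using elim(3) by (intro H_ge) (auto simp: G)
      qed
    qed
  qed
  have \<kappa>_M: "\<kappa> \<in> M \<rightarrow>\<^sub>M subprob_algebra borel"
    using measurable_from_subalg[OF sub measurable_prob_algebraD[OF \<kappa>_F]] .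
  have key: "(\<integral>\<^sup>+\<omega>. indicator A \<omega> * emeasure (\<kappa> \<omega>) B \<partial>M) = emeasure M (A \<inter> V -` B)"
    if A: "A \<in> sets F" and B: "B \<in> sets borel" for A B
  proof -
    have AM [measurable]: "A \<in> sets M" using A sub by (auto simp: subalgebra_def)
    have AV: "A \<inter> V -` B' = {\<omega>\<in>space M. \<omega> \<in> A \<and> V \<omega> \<in> B'}" for B'
      using sets.sets_into_space[OF AM] by auto
    define N where "N = density M (indicator A)"
    define \<mu> where "\<mu> = distr N borel V"
    define \<nu> where "\<nu> = bind N \<kappa>"
    have \<mu>: "emeasure \<mu> B' = emeasure M (A \<inter> V -` B')" if [measurable]: "B' \<in> sets borel" for B'
    proof -
      have "emeasure \<mu> B' = emeasure N (V -` B' \<inter> space M)"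
        unfolding \<mu>_def by (subst emeasure_distr) (auto simp: N_def)
      also have "\<dots> = (\<integral>\<^sup>+\<omega>. indicator A \<omega> * indicator (V -` B' \<inter> space M) \<omega> \<partial>M)"
        unfolding N_def by (subst emeasure_density) auto
      also have "\<dots> = (\<integral>\<^sup>+\<omega>. indicator (A \<inter> V -` B') \<omega> \<partial>M)"
        by (intro nn_integral_cong) (auto split: split_indicator)
      also have "\<dots> = emeasure M (A \<inter> V -` B')" unfolding AV by simp
      finally show ?thesis .
    qed
    have Nk: "\<kappa> \<in> N \<rightarrow>\<^sub>M subprob_algebra borel" using \<kappa>_M by (simp add: N_def)
    have \<nu>: "emeasure \<nu> B' = (\<integral>\<^sup>+\<omega>. indicator A \<omega> * emeasure (\<kappa> \<omega>) B' \<partial>M)"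
      if B': "B' \<in> sets borel" for B'
    proof -
      have "emeasure \<nu> B' = (\<integral>\<^sup>+\<omega>. emeasure (\<kappa> \<omega>) B' \<partial>N)"
        unfolding \<nu>_def using not_empty by (intro emeasure_bind[OF _ Nk B']) (simp add: N_def)
      also have "\<dots> = (\<integral>\<^sup>+\<omega>. indicator A \<omega> * emeasure (\<kappa> \<omega>) B' \<partial>M)"
        unfolding N_def using measurable_emeasure_kernel[OF \<kappa>_M B']
        by (intro nn_integral_density) auto
      finally show ?thesis .
    qed
    have s\<nu>: "sets \<nu> = sets borel"
      unfolding \<nu>_def using not_empty Nk by (intro sets_bind_measurable[OF Nk]) (simp add: N_def)
    have "\<mu> = \<nu>"
    proof (rule measure_eqI_generator_eq[where E="range atMost" and \<Omega>=UNIV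
          and A="\<lambda>n. {..real n}"])
      show "Int_stable (range (atMost :: real \<Rightarrow> real set))"
        by (auto simp: Int_stable_def)
      show "sets \<mu> = sigma_sets UNIV (range atMost)" "sets \<nu> = sigma_sets UNIV (range atMost)"
        unfolding s\<nu> by (simp_all add: \<mu>_def) (subst borel_eq_atMost, simp)+
      show "(\<Union>n. {..real n}) = UNIV" using real_arch_simple by auto
      show "emeasure \<mu> {..real n} \<noteq> \<infinity>" for n by (simp add: \<mu>)
      show "emeasure \<mu> X = emeasure \<nu> X" if "X \<in> range atMost" for X
      proof -
        from that obtain x where X: "X = {..x}" by auto
        have "emeasure \<nu> X = (\<integral>\<^sup>+\<omega>. ennreal (indicator A \<omega> * H \<omega> x) \<partial>M)"
          unfolding X by (subst \<nu>) (auto simp: \<kappa>_Iic intro!: nn_integral_cong split: split_indicator)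
        also have "\<dots> = (\<integral>\<^sup>+\<omega>. ennreal (indicator A \<omega> * E x \<omega>) \<partial>M)"
          using HE[of x] by (intro nn_integral_cong_AE) auto
        also have "\<dots> = ennreal (\<integral>\<omega>. indicator A \<omega> * E x \<omega> \<partial>M)"
          using E_0[of x] integrable_real_mult_indicator[OF AM Ei[of x]]
          by (intro nn_integral_eq_integral) (auto simp: mult.commute split: split_indicator)
        also have "(\<integral>\<omega>. indicator A \<omega> * E x \<omega> \<partial>M) = (\<integral>\<omega>. indicator A \<omega> * indicator {..x} (V \<omega>) \<partial>M)"
          unfolding E_def using real_cond_exp_intA[OF ii[of "{..x}"] A]
          by (simp add: set_lebesgue_integral_def)
        also have "\<dots> = (\<integral>\<omega>. indicator (A \<inter> V -` {..x}) \<omega> \<partial>M)"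
          by (intro Bochner_Integration.integral_cong) (auto simp: indicator_def)
        also have "\<dots> = measure M (A \<inter> V -` {..x})"
          unfolding AV by simp
        finally show ?thesis unfolding X by (subst \<mu>) (auto simp: emeasure_eq_measure)
      qed
    qed auto
    with \<mu>[OF B] \<nu>[OF B] show ?thesis by simp
  qed
  have "AE \<omega> in M. measure (\<kappa> \<omega>) B = real_cond_exp M F (\<lambda>\<omega>. indicator B (V \<omega>)) \<omega>"
    if B: "B \<in> sets borel" for B
  proof -
    have mF: "(\<lambda>\<omega>. measure (\<kappa> \<omega>) B) \<in> borel_measurable F"
      using measurable_compose[OF measurable_prob_algebraD[OF \<kappa>_F]
          measurable_measure_subprob_algebra[OF B]] .
    have p: "prob_space (\<kappa> \<omega>)" for \<omega> using rd[of \<omega>] by (simp add: real_distribution_def)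
    have mi: "integrable M (\<lambda>\<omega>. measure (\<kappa> \<omega>) B)"
      using measF[OF mF] prob_space.prob_le_1[OF p]
      by (intro integrable_const_bound[where B=1]) auto
    have "AE \<omega> in M. real_cond_exp M F (\<lambda>\<omega>. indicator B (V \<omega>)) \<omega> = measure (\<kappa> \<omega>) B"
    proof (rule real_cond_exp_charact[OF _ ii[OF B] mi mF])
      fix A assume A: "A \<in> sets F"
      then have AM [measurable]: "A \<in> sets M" using sub by (auto simp: subalgebra_def)
      have AV: "A \<inter> V -` B = {\<omega>\<in>space M. \<omega> \<in> A \<and> V \<omega> \<in> B}"
        using sets.sets_into_space[OF AM] by auto
      have "(\<integral>\<omega>\<in>A. indicator B (V \<omega>) \<partial>M) = (\<integral>\<omega>. indicator (A \<inter> V -` B) \<omega> \<partial>M)"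
        unfolding set_lebesgue_integral_def
        by (intro Bochner_Integration.integral_cong) (auto simp: indicator_def)
      also have "\<dots> = measure M (A \<inter> V -` B)" unfolding AV using B by simp
      also have "ennreal \<dots> = (\<integral>\<^sup>+\<omega>. indicator A \<omega> * emeasure (\<kappa> \<omega>) B \<partial>M)"
        using key[OF A B] by (simp add: emeasure_eq_measure)
      also have "\<dots> = (\<integral>\<^sup>+\<omega>. ennreal (indicator A \<omega> * measure (\<kappa> \<omega>) B) \<partial>M)"
        using p by (intro nn_integral_cong)
          (auto simp: finite_measure.emeasure_eq_measure prob_space.finite_measure split: split_indicator)
      also have "\<dots> = ennreal (\<integral>\<omega>. indicator A \<omega> * measure (\<kappa> \<omega>) B \<partial>M)"
        using integrable_real_mult_indicator[OF AM mi]
        by (intro nn_integral_eq_integral) (auto simp: mult.commute split: split_indicator)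
      finally show "(\<integral>\<omega>\<in>A. indicator B (V \<omega>) \<partial>M) = (\<integral>\<omega>\<in>A. measure (\<kappa> \<omega>) B \<partial>M)"
        unfolding set_lebesgue_integral_def
        by (subst (asm) ennreal_inj) (auto intro!: Bochner_Integration.integral_nonneg)
    qed
    then show ?thesis by eventually_elim simp
  qed
  with \<kappa>_F show ?thesis unfolding is_cond_distr_def by blast
qed

lemma is_cond_distr_cond_distr:
  assumes "prob_space M" "subalgebra M F" "V \<in> borel_measurable M"
  shows "is_cond_distr M F V (cond_distr M F V)"
  unfolding cond_distr_def by (rule someI_ex[OF ex_is_cond_distr[OF assms]])

end

(* Dominance at time t, compared in the limit of large eta, orders the conditional means:
   sigma_t + E_t[X_{t+1}|xi_t] >= E_t[Y_{t+1}|xi_t] almost surely. Since the future value at time t - 1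
   is X_t plus the conditional mean at time t, this says that sigma_{t-1} plus the future value of X
   at time t - 1 is almost surely at least the future value of Y. Such a pointwise inequality
   implies dominance of the conditional distributions, so the relation descends from T - 1 to 1. *)

theory Submission
  imports Defs
begin

section \<open>Second-order dominance and means\<close>

text \<open>Fubini for the indicator of the region x \<le> s \<le> \<eta>: integrating over x first
  gives the distribution function at s, integrating over s first gives the length of the interval
  from x to \<eta>. The integrand on the right is the positive part, since \<open>ennreal\<close>
  sends negative reals to 0.\<close>

lemma cdf2_eq_nn_integral:
  assumes "real_distribution \<mu>"
  shows "cdf2 \<mu> \<eta> = (\<integral>\<^sup>+ x. ennreal (\<eta> - x) \<partial>\<mu>)"
proof -
  interpret real_distribution \<mu> by fact
  interpret P: pair_sigma_finite lborel \<mu> ..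
  have "cdf2 \<mu> \<eta> = (\<integral>\<^sup>+ s. \<integral>\<^sup>+ x. indicator {(s, x). x \<le> s \<and> s \<le> \<eta>} (s, x) \<partial>\<mu> \<partial>lborel)"
    unfolding cdf2_def
  proof (intro nn_integral_cong)
    fix s :: real
    have "(\<integral>\<^sup>+ x. indicator {(s, x). x \<le> s \<and> s \<le> \<eta>} (s, x) \<partial>\<mu>) =
        (\<integral>\<^sup>+ x. indicator {..s} x * indicator {..\<eta>} s \<partial>\<mu>)"
      by (intro nn_integral_cong) (auto split: split_indicator)
    also have "\<dots> = emeasure \<mu> {..s} * indicator {..\<eta>} s"
      by (subst nn_integral_multc) auto
    finally show "ennreal (cdf \<mu> s) * indicator {..\<eta>} s =
        (\<integral>\<^sup>+ x. indicator {(s, x). x \<le> s \<and> s \<le> \<eta>} (s, x) \<partial>\<mu>)"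
      by (simp add: cdf_def emeasure_eq_measure)
  qed
  also have "\<dots> = (\<integral>\<^sup>+ x. \<integral>\<^sup>+ s. indicator {(s, x). x \<le> s \<and> s \<le> \<eta>} (s, x) \<partial>lborel \<partial>\<mu>)"
  proof (rule P.Fubini'[symmetric])
    have "{(s, x). x \<le> s \<and> s \<le> \<eta>} \<in> sets (borel \<Otimes>\<^sub>M (borel :: real measure))"
      unfolding borel_prod by (intro borel_closed)
        (auto simp: case_prod_beta' intro!: closed_Collect_conj closed_Collect_le continuous_intros)
    then have "{(s, x). x \<le> s \<and> s \<le> \<eta>} \<in> sets (lborel \<Otimes>\<^sub>M \<mu>)"
      by (simp cong: sets_pair_measure_cong)
    then show "(\<lambda>(s, x). indicator {(s, x). x \<le> s \<and> s \<le> \<eta>} (s, x)) \<in> borel_measurable (lborel \<Otimes>\<^sub>M \<mu>)"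
      by simp
  qed
  also have "\<dots> = (\<integral>\<^sup>+ x. ennreal (\<eta> - x) \<partial>\<mu>)"
  proof (intro nn_integral_cong)
    fix x :: real
    have "(\<integral>\<^sup>+ s. indicator {(s, x). x \<le> s \<and> s \<le> \<eta>} (s, x) \<partial>lborel) =
        (\<integral>\<^sup>+ s. indicator {x..\<eta>} s \<partial>lborel)"
      by (intro nn_integral_cong) (auto split: split_indicator)
    then show "(\<integral>\<^sup>+ s. indicator {(s, x). x \<le> s \<and> s \<le> \<eta>} (s, x) \<partial>lborel) = ennreal (\<eta> - x)"
      by (cases "x \<le> \<eta>") (auto simp: ennreal_neg)
  qed
  finally show ?thesis .
qed

text \<open>At each level \<eta>, the expected shortfall under \<mu> is at least \<eta> minus the
  mean of \<mu>, and the shortfall under \<nu> equals \<eta> minus the mean of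
  \<open>min \<eta> x\<close>. Dominance therefore bounds the truncated means of \<nu> by the mean
  of \<mu>, and the truncation is removed as \<eta> grows.\<close>

lemma ssd_imp_mean_le:
  assumes "real_distribution \<mu>" "real_distribution \<nu>"
    and \<mu>: "integrable \<mu> (\<lambda>x. x)" and \<nu>: "integrable \<nu> (\<lambda>x. x)" and "\<mu> \<succeq>\<^sub>2 \<nu>"
  shows "(\<integral>x. x \<partial>\<nu>) \<le> (\<integral>x. x \<partial>\<mu>)"
proof -
  interpret \<mu>: real_distribution \<mu> by fact
  interpret \<nu>: real_distribution \<nu> by fact
  \<comment> \<open>A first moment makes the shortfall finite, so the comparison in
    \<open>ennreal\<close> can be read as one between real integrals.\<close>
  have cdf2: "cdf2 \<rho> \<eta> = ennreal (\<integral>x. max 0 (\<eta> - x) \<partial>\<rho>)"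
    if "real_distribution \<rho>" "integrable \<rho> (\<lambda>x. x)" for \<rho> \<eta>
  proof -
    interpret real_distribution \<rho> by fact
    have "cdf2 \<rho> \<eta> = (\<integral>\<^sup>+ x. ennreal (max 0 (\<eta> - x)) \<partial>\<rho>)"
      unfolding cdf2_eq_nn_integral[OF that(1)] by (intro nn_integral_cong) (simp add: max_def ennreal_neg)
    also have "\<dots> = ennreal (\<integral>x. max 0 (\<eta> - x) \<partial>\<rho>)"
      using that(2) by (intro nn_integral_eq_integral) auto
    finally show ?thesis .
  qed
  have "(\<integral>x. min \<eta> x \<partial>\<nu>) \<le> (\<integral>x. x \<partial>\<mu>)" for \<eta> :: real
  proof -
    have "\<eta> - (\<integral>x. x \<partial>\<mu>) = (\<integral>x. \<eta> - x \<partial>\<mu>)"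
      using \<mu> \<mu>.prob_space[simplified] by (subst Bochner_Integration.integral_diff) simp_all
    also have "\<dots> \<le> (\<integral>x. max 0 (\<eta> - x) \<partial>\<mu>)"
      using \<mu> by (intro integral_mono) auto
    also have "\<dots> \<le> (\<integral>x. max 0 (\<eta> - x) \<partial>\<nu>)"
      using assms(5) unfolding ssd_def cdf2[OF assms(1) \<mu>] cdf2[OF assms(2) \<nu>]
      by (subst (asm) ennreal_le_iff) (auto intro!: Bochner_Integration.integral_nonneg)
    also have "\<dots> = (\<integral>x. \<eta> - min \<eta> x \<partial>\<nu>)"
      by (intro Bochner_Integration.integral_cong) auto
    also have "\<dots> = \<eta> - (\<integral>x. min \<eta> x \<partial>\<nu>)"
      using \<nu> \<nu>.prob_space[simplified] by (subst Bochner_Integration.integral_diff) simp_all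
    finally show ?thesis by simp
  qed
  \<comment> \<open>The truncation levels are natural numbers, hence nonnegative; this is what makes
    the absolute value a dominating function for \<open>min (real n) x\<close>.\<close>
  moreover have "(\<lambda>n. \<integral>x. min (real n) x \<partial>\<nu>) \<longlonglongrightarrow> (\<integral>x. x \<partial>\<nu>)"
  proof (rule integral_dominated_convergence[where w="\<lambda>x. \<bar>x\<bar>"])
    show "AE x in \<nu>. (\<lambda>n. min (real n) x) \<longlonglongrightarrow> x"
    proof (intro AE_I2 tendsto_eventually)
      fix x :: real
      obtain k where "x \<le> real k" using real_arch_simple by blast
      then show "\<forall>\<^sub>F n in sequentially. min (real n) x = x"
        unfolding eventually_sequentially by (intro exI[of _ k]) auto
    qed
    show "AE x in \<nu>. norm (min (real n) x) \<le> \<bar>x\<bar>" for n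
      by (intro AE_I2) (simp add: min_def)
    show "integrable \<nu> (\<lambda>x. \<bar>x\<bar>)" using \<nu> by (rule integrable_abs)
  qed measurable
  ultimately show ?thesis by (intro LIMSEQ_le_const2) blast+
qed

section \<open>Conditional distributions and conditional expectations\<close>

text \<open>Valid at every outcome of the space and not only almost everywhere, because
  \<open>is_cond_distr\<close> asks for a kernel into \<open>prob_algebra\<close>.\<close>

lemma is_cond_distr_real_distribution:
  assumes "is_cond_distr M F V \<kappa>" "subalgebra M F" "\<omega> \<in> space M"
  shows "real_distribution (\<kappa> \<omega>)"
proof -
  have "\<kappa> \<omega> \<in> space (prob_algebra borel)"
    using assms by (auto simp: is_cond_distr_def subalgebra_def dest: measurable_space)
  then show ?thesis
    by (auto simp: space_prob_algebra real_distribution_def real_distribution_axioms_def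
        dest: sets_eq_imp_space_eq)
qed

text \<open>For an event A in F, mixing \<kappa> over the measure M restricted to A gives the law of
  V under that restriction. Integrating h against this one measure in its two forms yields the
  characteristic property of the conditional expectation, without approximating h by simple
  functions here.\<close>

lemma nn_cond_exp_is_cond_distr:
  assumes "prob_space M" and sub: "subalgebra M F" and V [measurable]: "V \<in> borel_measurable M"
    and \<kappa>: "is_cond_distr M F V \<kappa>" and h [measurable]: "h \<in> borel_measurable borel"
  shows "AE \<omega> in M. (\<integral>\<^sup>+ x. h x \<partial>\<kappa> \<omega>) = nn_cond_exp M F (\<lambda>\<omega>. h (V \<omega>)) \<omega>"
proof -
  interpret prob_space M by fact
  interpret finite_measure_subalgebra M F by unfold_locales (rule sub)
  have \<kappa>F: "\<kappa> \<in> F \<rightarrow>\<^sub>M subprob_algebra borel"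
    using \<kappa> by (auto simp: is_cond_distr_def intro: measurable_prob_algebraD)
  have \<kappa>M: "\<kappa> \<in> M \<rightarrow>\<^sub>M subprob_algebra borel" by (rule measurable_from_subalg[OF sub \<kappa>F])
  note rd = is_cond_distr_real_distribution[OF \<kappa> sub]
  show ?thesis
  proof (rule nn_cond_exp_charact)
    show "(\<lambda>\<omega>. \<integral>\<^sup>+ x. h x \<partial>\<kappa> \<omega>) \<in> borel_measurable F"
      using \<kappa>F by (rule measurable_compose) (rule nn_integral_measurable_subprob_algebra[OF h])
    fix A assume A: "A \<in> sets F"
    then have [measurable]: "A \<in> sets M" using sub by (auto simp: subalgebra_def)
    define N where "N = density M (indicator A)"
    have N\<kappa>: "\<kappa> \<in> N \<rightarrow>\<^sub>M subprob_algebra borel" using \<kappa>M by (simp add: N_def)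
    have N0: "space N \<noteq> {}" using not_empty by (simp add: N_def)
    \<comment> \<open>On a Borel set B both measures give the mass of the part of A where V lies in
      B. For the mixture this is the averaging property of the conditional probability of B over
      A.\<close>
    have "N \<bind> \<kappa> = distr N borel V"
    proof (rule measure_eqI)
      show "sets (N \<bind> \<kappa>) = sets (distr N borel V)"
        by (simp add: sets_bind_measurable[OF N\<kappa> N0])
      fix B assume "B \<in> sets (N \<bind> \<kappa>)"
      then have B [measurable]: "B \<in> sets borel" by (simp add: sets_bind_measurable[OF N\<kappa> N0])
      have ii: "integrable M (\<lambda>\<omega>. indicator B (V \<omega>) :: real)"
        by (intro integrable_const_bound[where B=1]) (auto simp: indicator_def)
      note ci = real_cond_exp_int(1)[OF ii]
      have "emeasure (N \<bind> \<kappa>) B = (\<integral>\<^sup>+ \<omega>. indicator A \<omega> * emeasure (\<kappa> \<omega>) B \<partial>M)"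
        unfolding emeasure_bind[OF N0 N\<kappa> B] unfolding N_def
        using measurable_emeasure_kernel[OF \<kappa>M B] by (intro nn_integral_density) auto
      also have "\<dots> = (\<integral>\<^sup>+ \<omega>. ennreal (indicator A \<omega> * measure (\<kappa> \<omega>) B) \<partial>M)"
      proof (intro nn_integral_cong)
        fix \<omega> assume "\<omega> \<in> space M"
        then interpret k: real_distribution "\<kappa> \<omega>" by (rule rd)
        show "indicator A \<omega> * emeasure (\<kappa> \<omega>) B = ennreal (indicator A \<omega> * measure (\<kappa> \<omega>) B)"
          by (simp add: k.emeasure_eq_measure split: split_indicator)
      qed
      also have "\<dots> = (\<integral>\<^sup>+ \<omega>. ennreal (indicator A \<omega> *
          real_cond_exp M F (\<lambda>\<omega>. indicator B (V \<omega>)) \<omega>) \<partial>M)"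
      proof (rule nn_integral_cong_AE)
        have "AE \<omega> in M. measure (\<kappa> \<omega>) B = real_cond_exp M F (\<lambda>\<omega>. indicator B (V \<omega>)) \<omega>"
          using \<kappa> B by (simp add: is_cond_distr_def)
        then show "AE \<omega> in M. ennreal (indicator A \<omega> * measure (\<kappa> \<omega>) B) =
            ennreal (indicator A \<omega> * real_cond_exp M F (\<lambda>\<omega>. indicator B (V \<omega>)) \<omega>)"
          by eventually_elim simp
      qed
      \<comment> \<open>The passage to a real integral makes the averaging identity for
        \<open>real_cond_exp\<close> applicable; the integrand is nonnegative almost
        everywhere.\<close>
      also have "\<dots> = ennreal (\<integral>\<omega>. indicator A \<omega> *
          real_cond_exp M F (\<lambda>\<omega>. indicator B (V \<omega>)) \<omega> \<partial>M)"
      proof (rule nn_integral_eq_integral)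
        show "integrable M (\<lambda>\<omega>. indicator A \<omega> * real_cond_exp M F (\<lambda>\<omega>. indicator B (V \<omega>)) \<omega>)"
          using integrable_real_mult_indicator[OF _ ci, of A] by (simp add: mult.commute)
        have "AE \<omega> in M. 0 \<le> real_cond_exp M F (\<lambda>\<omega>. indicator B (V \<omega>)) \<omega>"
          by (intro real_cond_exp_pos) auto
        then show "AE \<omega> in M. 0 \<le> indicator A \<omega> * real_cond_exp M F (\<lambda>\<omega>. indicator B (V \<omega>)) \<omega>"
          by eventually_elim simp
      qed
      also have "(\<integral>\<omega>. indicator A \<omega> * real_cond_exp M F (\<lambda>\<omega>. indicator B (V \<omega>)) \<omega> \<partial>M) =
          (\<integral>\<omega>. indicator A \<omega> * indicator B (V \<omega>) \<partial>M)"
        using real_cond_exp_intA[OF ii A] by (simp add: set_lebesgue_integral_def)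
      also have "ennreal \<dots> = (\<integral>\<^sup>+ \<omega>. ennreal (indicator A \<omega> * indicator B (V \<omega>)) \<partial>M)"
        using integrable_real_mult_indicator[OF _ ii, of A]
        by (intro nn_integral_eq_integral[symmetric]) (auto simp: mult.commute)
      also have "\<dots> = (\<integral>\<^sup>+ \<omega>. indicator A \<omega> * indicator (V -` B \<inter> space M) \<omega> \<partial>M)"
        by (intro nn_integral_cong) (auto split: split_indicator)
      also have "\<dots> = emeasure (distr N borel V) B"
        unfolding N_def by (subst emeasure_distr) (auto simp: emeasure_density)
      finally show "emeasure (N \<bind> \<kappa>) B = emeasure (distr N borel V) B" .
    qed
    \<comment> \<open>From sets to functions: h is integrated against both forms of the measure, and
      the density of N then turns back into the factor \<open>indicator A\<close>.\<close>
    then have "(\<integral>\<^sup>+ x. h x \<partial>distr N borel V) = (\<integral>\<^sup>+ \<omega>. \<integral>\<^sup>+ x. h x \<partial>\<kappa> \<omega> \<partial>N)"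
      using nn_integral_bind[OF h N\<kappa>] by simp
    moreover have "(\<integral>\<^sup>+ x. h x \<partial>distr N borel V) = (\<integral>\<^sup>+ \<omega>. indicator A \<omega> * h (V \<omega>) \<partial>M)"
      unfolding N_def by (simp add: nn_integral_distr nn_integral_density)
    moreover have "(\<integral>\<^sup>+ \<omega>. \<integral>\<^sup>+ x. h x \<partial>\<kappa> \<omega> \<partial>N) = (\<integral>\<^sup>+ \<omega>. indicator A \<omega> * (\<integral>\<^sup>+ x. h x \<partial>\<kappa> \<omega>) \<partial>M)"
      unfolding N_def
      using measurable_compose[OF \<kappa>M nn_integral_measurable_subprob_algebra[OF h]]
      by (intro nn_integral_density) auto
    ultimately show "(\<integral>\<^sup>+ \<omega>\<in>A. h (V \<omega>) \<partial>M) = (\<integral>\<^sup>+ \<omega>\<in>A. (\<integral>\<^sup>+ x. h x \<partial>\<kappa> \<omega>) \<partial>M)"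
      by (simp add: mult.commute)
  qed measurable
qed

text \<open>The nonnegative case is applied to the absolute value and to the positive and negative
  parts of the identity. The first gives integrability; the other two match because
  \<open>real_cond_exp\<close> and the real integral are both differences of such parts.\<close>

lemma real_cond_exp_is_cond_distr:
  assumes "prob_space M" and sub: "subalgebra M F" and V: "integrable M V"
    and \<kappa>: "is_cond_distr M F V \<kappa>"
  shows "AE \<omega> in M. integrable (\<kappa> \<omega>) (\<lambda>x. x) \<and> real_cond_exp M F V \<omega> = (\<integral>x. x \<partial>\<kappa> \<omega>)"
proof -
  interpret prob_space M by fact
  interpret finite_measure_subalgebra M F by unfold_locales (rule sub)
  have [measurable]: "V \<in> borel_measurable M" using V by simp
  note nn = nn_cond_exp_is_cond_distr[OF \<open>prob_space M\<close> sub \<open>V \<in> borel_measurable M\<close> \<kappa>]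
  \<comment> \<open>Conditioning preserves the total integral, so the conditional expectation of the
    absolute value of V is finite almost everywhere.\<close>
  have "(\<integral>\<^sup>+ \<omega>. nn_cond_exp M F (\<lambda>\<omega>. ennreal \<bar>V \<omega>\<bar>) \<omega> \<partial>M) = (\<integral>\<^sup>+ \<omega>. ennreal \<bar>V \<omega>\<bar> \<partial>M)"
    using nn_cond_exp_intg[of "\<lambda>_. 1" "\<lambda>\<omega>. ennreal \<bar>V \<omega>\<bar>"] by simp
  also have "\<dots> \<noteq> \<infinity>" using V by (simp add: integrable_iff_bounded)
  finally have "AE \<omega> in M. nn_cond_exp M F (\<lambda>\<omega>. ennreal \<bar>V \<omega>\<bar>) \<omega> \<noteq> \<infinity>"
    by (intro nn_integral_noteq_infinite) auto
  then show ?thesis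
    using nn[of "\<lambda>x. ennreal \<bar>x\<bar>", simplified] nn[of "\<lambda>x. ennreal x", simplified]
      nn[of "\<lambda>x. ennreal (- x)", simplified] AE_space
  proof eventually_elim
    case (elim \<omega>)
    interpret k: real_distribution "\<kappa> \<omega>"
      by (rule is_cond_distr_real_distribution[OF \<kappa> sub elim(5)])
    have "integrable (\<kappa> \<omega>) (\<lambda>x. x)"
      using elim by (simp add: integrable_iff_bounded less_top)
    with elim(3,4) show ?case
      by (simp add: real_cond_exp_def real_lebesgue_integral_def)
  qed
qed

text \<open>
  The bound compares \<open>V \<le> p\<close> with \<open>W \<le> p + q\<close> on the \<open>F\<close>-measurable event \<open>\<sigma> \<le> q\<close>, for rational
  \<open>p\<close> and \<open>q\<close>; right-continuity of the distribution function then replaces \<open>q\<close> by \<open>\<sigma>\<close>.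
\<close>

lemma AE_le_imp_ssd_cond_distr:
  assumes "prob_space M" and sub: "subalgebra M F"
    and V [measurable]: "V \<in> borel_measurable M" and W [measurable]: "W \<in> borel_measurable M"
    and \<sigma>: "\<sigma> \<in> borel_measurable F" and le: "AE \<omega> in M. W \<omega> \<le> \<sigma> \<omega> + V \<omega>"
    and \<kappa>: "is_cond_distr M F V \<kappa>" and \<nu>: "is_cond_distr M F W \<nu>"
  shows "AE \<omega> in M. distr (\<kappa> \<omega>) borel (\<lambda>x. \<sigma> \<omega> + x) \<succeq>\<^sub>2 \<nu> \<omega>"
proof -
  interpret prob_space M by fact
  interpret finite_measure_subalgebra M F by unfold_locales (rule sub)
  have [measurable]: "\<sigma> \<in> borel_measurable M" by (rule measurable_from_subalg[OF sub \<sigma>])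
  have bound: "AE \<omega> in M. \<sigma> \<omega> \<le> q \<longrightarrow> cdf (\<kappa> \<omega>) p \<le> cdf (\<nu> \<omega>) (p + q)" for p q :: real
  proof -
    \<comment> \<open>The event where \<sigma> is at most q belongs to F, so its indicator factors
      out of the conditional expectation. On that event, V \<le> p forces W \<le> p + q almost
      surely.\<close>
    define I where "I = (\<lambda>\<omega>. indicator {..q} (\<sigma> \<omega>) :: real)"
    have IF: "I \<in> borel_measurable F" unfolding I_def using \<sigma> by measurable
    have [measurable]: "I \<in> borel_measurable M" by (rule measurable_from_subalg[OF sub IF])
    have int1: "integrable M (\<lambda>\<omega>. I \<omega> * indicator {..p} (V \<omega>))"
      by (intro integrable_const_bound[where B=1]) (auto simp: I_def indicator_def)
    have int2: "integrable M (\<lambda>\<omega>. indicator {..p + q} (W \<omega>) :: real)"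
      by (intro integrable_const_bound[where B=1]) (auto simp: indicator_def)
    have "AE \<omega> in M. real_cond_exp M F (\<lambda>\<omega>. I \<omega> * indicator {..p} (V \<omega>)) \<omega>
        \<le> real_cond_exp M F (\<lambda>\<omega>. indicator {..p + q} (W \<omega>)) \<omega>"
      using le by (intro real_cond_exp_mono int1 int2, eventually_elim)
        (auto simp: I_def indicator_def)
    moreover have "AE \<omega> in M. real_cond_exp M F (\<lambda>\<omega>. I \<omega> * indicator {..p} (V \<omega>)) \<omega>
        = I \<omega> * real_cond_exp M F (\<lambda>\<omega>. indicator {..p} (V \<omega>)) \<omega>"
      by (intro real_cond_exp_mult IF int1) auto
    moreover have "AE \<omega> in M. measure (\<kappa> \<omega>) {..p} = real_cond_exp M F (\<lambda>\<omega>. indicator {..p} (V \<omega>)) \<omega>"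
      "AE \<omega> in M. measure (\<nu> \<omega>) {..p + q} = real_cond_exp M F (\<lambda>\<omega>. indicator {..p + q} (W \<omega>)) \<omega>"
      using \<kappa> \<nu> by (auto simp: is_cond_distr_def)
    ultimately show ?thesis
      by eventually_elim (auto simp: I_def cdf_def)
  qed
  \<comment> \<open>Countably many pairs leave a single null set, off which all the bounds hold
    together and \<omega> can be fixed.\<close>
  have "AE \<omega> in M. \<forall>p q :: rat. \<sigma> \<omega> \<le> of_rat q \<longrightarrow>
      cdf (\<kappa> \<omega>) (of_rat p) \<le> cdf (\<nu> \<omega>) (of_rat p + of_rat q)"
    unfolding AE_all_countable using bound by blast
  then show ?thesis using AE_space
  proof eventually_elim
    case (elim \<omega>)
    interpret k: real_distribution "\<kappa> \<omega>"
      by (rule is_cond_distr_real_distribution[OF \<kappa> sub elim(2)])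
    interpret l: real_distribution "\<nu> \<omega>"
      by (rule is_cond_distr_real_distribution[OF \<nu> sub elim(2)])
    have "cdf (distr (\<kappa> \<omega>) borel (\<lambda>x. \<sigma> \<omega> + x)) s \<le> cdf (\<nu> \<omega>) s" for s
    proof -
      have "cdf (\<kappa> \<omega>) (s - \<sigma> \<omega>) \<le> cdf (\<nu> \<omega>) u" if "s < u" for u
      proof -
        \<comment> \<open>The gap between s and u is split in half: q exceeds \<sigma> and p exceeds
          s - \<sigma> by less than half of it, so p + q stays below u.\<close>
        obtain q :: rat where q: "\<sigma> \<omega> < of_rat q" "of_rat q < \<sigma> \<omega> + (u - s) / 2"
          using of_rat_dense[of "\<sigma> \<omega>" "\<sigma> \<omega> + (u - s) / 2"] \<open>s < u\<close> by auto
        obtain p :: rat where p: "s - \<sigma> \<omega> < of_rat p" "of_rat p < s - \<sigma> \<omega> + (u - s) / 2"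
          using of_rat_dense[of "s - \<sigma> \<omega>" "s - \<sigma> \<omega> + (u - s) / 2"] \<open>s < u\<close> by auto
        have "cdf (\<kappa> \<omega>) (s - \<sigma> \<omega>) \<le> cdf (\<kappa> \<omega>) (of_rat p)"
          using p(1) by (intro k.cdf_nondecreasing) simp
        also have "\<dots> \<le> cdf (\<nu> \<omega>) (of_rat p + of_rat q)"
          using elim(1) q(1) by simp
        also have "\<dots> \<le> cdf (\<nu> \<omega>) u"
          using p(2) q(2) by (intro l.cdf_nondecreasing) (simp add: field_simps)
        finally show ?thesis .
      qed
      then have "cdf (\<kappa> \<omega>) (s - \<sigma> \<omega>) \<le> cdf (\<nu> \<omega>) s"
        by (intro tendsto_lowerbound[OF l.cdf_is_right_cont[unfolded continuous_within]])
          (auto simp: eventually_at_right_field intro: gt_ex)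
      moreover have "cdf (distr (\<kappa> \<omega>) borel (\<lambda>x. \<sigma> \<omega> + x)) s = cdf (\<kappa> \<omega>) (s - \<sigma> \<omega>)"
        unfolding cdf_def by (subst measure_distr) (auto intro!: arg_cong[where f="measure (\<kappa> \<omega>)"])
      ultimately show ?thesis by simp
    qed
    \<comment> \<open>The pointwise order of the distribution functions is first-order dominance;
      integrating it gives the second-order relation.\<close>
    then show ?case
      unfolding ssd_def cdf2_def
      by (auto intro!: nn_integral_mono mult_right_mono ennreal_leI)
  qed
qed

text \<open>Dominance orders the means, the means of the conditional distributions are the
  conditional expectations, and at a fixed outcome the translation adds the constant
  \<open>\<sigma> \<omega>\<close> to the mean.\<close>

lemma ssd_cond_distr_imp_cond_exp_le:
  assumes "prob_space M" and sub: "subalgebra M F" and V: "integrable M V" and W: "integrable M W"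
    and \<kappa>: "is_cond_distr M F V \<kappa>" and \<nu>: "is_cond_distr M F W \<nu>"
    and ssd: "AE \<omega> in M. distr (\<kappa> \<omega>) borel (\<lambda>x. \<sigma> \<omega> + x) \<succeq>\<^sub>2 \<nu> \<omega>"
  shows "AE \<omega> in M. real_cond_exp M F W \<omega> \<le> \<sigma> \<omega> + real_cond_exp M F V \<omega>"
  using ssd real_cond_exp_is_cond_distr[OF assms(1) sub V \<kappa>]
    real_cond_exp_is_cond_distr[OF assms(1) sub W \<nu>] AE_space
proof eventually_elim
  case (elim \<omega>)
  interpret k: real_distribution "\<kappa> \<omega>"
    by (rule is_cond_distr_real_distribution[OF \<kappa> sub elim(4)])
  have "(\<integral>x. x \<partial>\<nu> \<omega>) \<le> (\<integral>x. x \<partial>distr (\<kappa> \<omega>) borel (\<lambda>x. \<sigma> \<omega> + x))"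
    using elim is_cond_distr_real_distribution[OF \<nu> sub elim(4)]
    by (intro ssd_imp_mean_le) (auto simp: integrable_distr_eq)
  also have "\<dots> = \<sigma> \<omega> + (\<integral>x. x \<partial>\<kappa> \<omega>)"
    using elim(2) k.prob_space[simplified] by (simp add: integral_distr)
  finally show ?case using elim(2,3) by simp
qed

section \<open>The filtration generated by the data process\<close>

lemma subalgebra_history_algebra:
  assumes "\<And>s. s \<in> {1..t} \<Longrightarrow> \<xi> s \<in> M \<rightarrow>\<^sub>M N s"
  shows "subalgebra M (history_algebra M N \<xi> t)"
proof -
  have "history \<xi> t \<in> M \<rightarrow>\<^sub>M (\<Pi>\<^sub>M s\<in>{1..t}. N s)"
    unfolding history_def using assms by (intro measurable_restrict) auto
  then show ?thesis
    unfolding subalgebra_def history_algebra_def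
    by (auto simp: sets_vimage_algebra2 measurable_space measurable_sets)
qed

text \<open>The shorter history is a coordinate restriction of the longer one, hence measurable with
  respect to the algebra of the longer one.\<close>

lemma history_algebra_mono:
  assumes "\<And>u. u \<in> {1..t} \<Longrightarrow> \<xi> u \<in> M \<rightarrow>\<^sub>M N u" and "s \<le> t"
  shows "subalgebra (history_algebra M N \<xi> t) (history_algebra M N \<xi> s)"
proof -
  let ?F = "history_algebra M N \<xi> t"
  have sp: "history \<xi> u \<in> space M \<rightarrow> space (\<Pi>\<^sub>M s\<in>{1..u}. N s)" if "u \<le> t" for u
    unfolding history_def[abs_def] space_PiM
  proof (intro funcsetI restrict_PiE_iff[THEN iffD2] ballI)
    fix \<omega> i assume "\<omega> \<in> space M" "i \<in> {1..u}"
    with that show "\<xi> i \<omega> \<in> space (N i)" by (intro measurable_space[OF assms(1)]) auto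
  qed
  have "history \<xi> t \<in> ?F \<rightarrow>\<^sub>M (\<Pi>\<^sub>M s\<in>{1..t}. N s)"
    unfolding history_algebra_def by (rule measurable_vimage_algebra1[OF sp]) simp
  then have "(\<lambda>\<omega>. restrict (history \<xi> t \<omega>) {1..s}) \<in> ?F \<rightarrow>\<^sub>M (\<Pi>\<^sub>M s\<in>{1..s}. N s)"
    using \<open>s \<le> t\<close> by (intro measurable_compose[OF _ measurable_restrict_subset]) auto
  also have "(\<lambda>\<omega>. restrict (history \<xi> t \<omega>) {1..s}) = history \<xi> s"
    using \<open>s \<le> t\<close> by (auto simp: history_def fun_eq_iff restrict_def)
  finally have "history \<xi> s \<in> ?F \<rightarrow>\<^sub>M (\<Pi>\<^sub>M s\<in>{1..s}. N s)" .
  moreover have "space ?F = space M" by (simp add: history_algebra_def)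
  ultimately show ?thesis
    unfolding subalgebra_def history_algebra_def[of M N \<xi> s]
    using sp[OF \<open>s \<le> t\<close>] by (auto simp: sets_vimage_algebra2 dest!: measurable_sets)
qed

section \<open>Descent in time\<close>

lemma integrable_nested_value:
  assumes "prob_space M" and "\<And>u. u \<in> {s..s + k} \<Longrightarrow> subalgebra M (F u)"
    and "\<And>u. u \<in> {s..s + k} \<Longrightarrow> integrable M (X u)"
  shows "integrable M (nested_value M F X s k)"
  using assms(2,3)
proof (induction k arbitrary: s)
  case (Suc k)
  interpret prob_space M by fact
  interpret finite_measure_subalgebra M "F s" by unfold_locales (rule Suc.prems, simp)
  have "integrable M (nested_value M F X (Suc s) k)"
    by (rule Suc.IH) (use Suc.prems in auto)
  then show ?case using Suc.prems(2)[of s] real_cond_exp_int(1) by simp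
qed simp

text \<open>The conditional means at time t + 1 are the inner terms of the future values at time t,
  so dominance at t + 1 becomes an almost sure inequality between those future values, which in turn
  gives dominance of their conditional distributions at t.\<close>

lemma dominates_at_step:
  assumes "prob_space M" and "t + 1 < T"
    and sub: "\<And>s. s \<in> {t..T} \<Longrightarrow> subalgebra M (F s)"
    and X: "\<And>s. s \<in> {t..T} \<Longrightarrow> integrable M (X s)" and Y: "\<And>s. s \<in> {t..T} \<Longrightarrow> integrable M (Y s)"
    and \<sigma>: "acc_diff X Y t \<in> borel_measurable (F t)"
    and dom: "dominates_at M F T X Y (t + 1)"
  shows "dominates_at M F T X Y t"
proof -
  \<comment> \<open>Since t + 1 < T, the nesting depth \<open>T - (t + 1)\<close> is a successor and
    one layer can be unfolded.\<close>
  have fv: "future_value M F T Z t \<omega> =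
      Z (t + 1) \<omega> + real_cond_exp M (F (t + 1)) (future_value M F T Z (t + 1)) \<omega>" for Z \<omega>
    using \<open>t + 1 < T\<close> by (simp add: future_value_def Suc_diff_Suc[symmetric])
  have fi: "integrable M (future_value M F T Z s)"
    if "\<And>s. s \<in> {t..T} \<Longrightarrow> integrable M (Z s)" "s \<in> {t, t + 1}" for Z s
    unfolding future_value_def using that \<open>t + 1 < T\<close>
    by (intro integrable_nested_value \<open>prob_space M\<close> sub) auto
  have cd: "is_cond_distr M (F s) V (cond_distr M (F s) V)"
    if "integrable M V" "s \<in> {t, t + 1}" for V s
    using that \<open>t + 1 < T\<close> by (intro is_cond_distr_cond_distr \<open>prob_space M\<close> sub) auto
  let ?V = "future_value M F T X" and ?W = "future_value M F T Y"
  have "AE \<omega> in M. real_cond_exp M (F (t + 1)) (?W (t + 1)) \<omega>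
      \<le> acc_diff X Y (t + 1) \<omega> + real_cond_exp M (F (t + 1)) (?V (t + 1)) \<omega>"
    by (rule ssd_cond_distr_imp_cond_exp_le[OF \<open>prob_space M\<close> _ _ _ _ _ dom[unfolded dominates_at_def]])
      (use \<open>t + 1 < T\<close> in \<open>auto intro!: sub fi cd X Y\<close>)
  \<comment> \<open>Adding \<open>Y (t + 1)\<close> to both sides suffices, because the accumulated
    difference at t + 1 is the one at t plus \<open>X (t + 1) - Y (t + 1)\<close>.\<close>
  then have "AE \<omega> in M. ?W t \<omega> \<le> acc_diff X Y t \<omega> + ?V t \<omega>"
    by eventually_elim (simp add: fv acc_diff_def acc_sum_def)
  moreover have "integrable M (?V t)" "integrable M (?W t)"
    by (auto intro!: fi X Y)
  ultimately show ?thesis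
    unfolding dominates_at_def
    using \<open>t + 1 < T\<close> cd[of "?V t" t] cd[of "?W t" t]
    by (intro AE_le_imp_ssd_cond_distr[OF \<open>prob_space M\<close> _ _ _ \<sigma>] sub)
      (simp_all add: borel_measurable_integrable)
qed

theorem theorem1:
  fixes M :: "'a measure" and N :: "nat \<Rightarrow> 'b measure" and \<xi> :: "nat \<Rightarrow> 'a \<Rightarrow> 'b"
    and F :: "nat \<Rightarrow> 'a measure" and T :: nat and X Y :: "nat \<Rightarrow> 'a \<Rightarrow> real"
  assumes "prob_space M"
    and "T \<ge> 2"
    and "\<And>t. t \<in> {1..T} \<Longrightarrow> \<xi> t \<in> M \<rightarrow>\<^sub>M N t"
    and "\<And>t. t \<in> {1..T} \<Longrightarrow> F t = history_algebra M N \<xi> t"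
    and "sets (F T) = sets M"
    and "\<And>t. t \<in> {1..T} \<Longrightarrow> integrable (restr_to_subalg M (F t)) (X t)"
    and "\<And>t. t \<in> {1..T} \<Longrightarrow> integrable (restr_to_subalg M (F t)) (Y t)"
    and "dominates_at M F T X Y (T - 1)"
  shows "\<forall>t \<in> {1..T - 1}. dominates_at M F T X Y t"
proof -
  have sub: "subalgebra M (F t)" if "t \<in> {1..T}" for t
    using that subalgebra_history_algebra[of t \<xi> M N] assms(3) by (simp add: assms(4))
  have mono: "subalgebra (F t) (F s)" if "s \<in> {1..t}" "t \<le> T" for s t
    using that history_algebra_mono[of t \<xi> M N s] assms(3) by (simp add: assms(4))
  have int: "integrable M (X t)" "integrable M (Y t)" if "t \<in> {1..T}" for t
    using integrable_from_subalg[OF sub[OF that]] assms(6,7)[OF that] by auto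
  have meas: "X t \<in> borel_measurable (F t)" "Y t \<in> borel_measurable (F t)" if "t \<in> {1..T}" for t
    using assms(6,7)[OF that] by (auto intro!: measurable_in_subalg'[OF sub[OF that]])
  \<comment> \<open>Each summand is measurable for the algebra of its own time s \<le> t, and the
    algebras increase.\<close>
  have \<sigma>: "acc_diff X Y t \<in> borel_measurable (F t)" if "t \<le> T" for t
  proof -
    have "X s \<in> borel_measurable (F t)" "Y s \<in> borel_measurable (F t)" if "s \<in> {1..t}" for s
      using meas[of s] measurable_from_subalg[OF mono[OF that \<open>t \<le> T\<close>]] that \<open>t \<le> T\<close> by auto
    then show ?thesis
      unfolding acc_diff_def acc_sum_def
      by (intro borel_measurable_diff borel_measurable_sum) auto
  qed
  \<comment> \<open>The induction runs downwards from T - 1. The bound 1 \<le> t is carried along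
    because \<open>F\<close> is specified only on \<open>{1..T}\<close>.\<close>
  have "dominates_at M F T X Y t" if "t \<le> T - 1" "1 \<le> t" for t
    using that
  proof (induction t rule: inc_induct)
    case base
    show ?case by fact
  next
    case (step t)
    then show ?case
      using dominates_at_step[OF assms(1), of t T F X Y] sub int \<sigma> by auto
  qed
  then show ?thesis by auto
qed

end
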